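(* For every integer $k \ge 1$, $|I_k(321)|$ equals the number of parallelogram polyominoes with $k$ cells.
   Context: A permutation of length $n$ is a word $\pi=\pi_1\cdots\pi_n$ containing each of $1,\dots,n$ exactly once. The sum of permutations $\rho=\rho_1\cdots\rho_n$ and $\tau=\tau_1\cdots\tau_m$ is the permutation $\rho\oplus\tau=\rho_1\cdots\rho_n(n+\tau_1)\cdots(n+\tau_m)$ of length $n+m$. A permutation is decomposable if it equals $\rho\oplus\tau$ for some non-empty permutations $\rho,\tau$; a non-empty permutation that is not decomposable is indecomposable. An inversion of $\pi$ is a pair $(i,j)$ with $i<j$ and $\pi_i>\pi_j$. A permutation $\pi$ contains a permutation (pattern) $\tau=\tau_1\cdots\tau_m$ if there are indices $i_1<\dots<i_m$ such that $\pi_{i_1},\dots,\pi_{i_m}$ is order-isomorphic to $\tau_1,\dots,\tau_m$; otherwise $\pi$ avoids $\tau$. $I_k(\tau_1,\dots,\tau_r)$ denotes the (finite) set of all indecomposable permutations, of any length, with exactly $k$ inversions that avoid all of $\tau_1,\dots,\tau_r$. A parallelogram polyomino is a pair of weakly increasing sequences of non-negative integers $(\ell_1,\dots,\ell_n)$ and $(r_1,\dots,r_n)$, for some $n\ge 1$, such that $\ell_1=0$, $\ell_i<r_i$ for all $1\le i\le n$, and $\ell_{i+1}<r_i$ for all $1\le i<n$. It is viewed as the union of the unit cells in the segment $[\ell_i,r_i]$ at height $i$, so its number of cells is $\sum_{i=1}^n (r_i-\ell_i)$. *)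

theory Defs
  imports Main
begin

text \<open>A permutation is a word over \<open>{1..n}\<close>, represented as a list. Entries are values
  \<open>1, \<dots>, n\<close>, whereas list positions are counted from 0.\<close>

definition is_perm :: "nat list \<Rightarrow> bool" where
  "is_perm p \<longleftrightarrow> distinct p \<and> set p = {1..length p}"

definition perm_sum :: "nat list \<Rightarrow> nat list \<Rightarrow> nat list" where
  "perm_sum p q = p @ map (\<lambda>x. length p + x) q"

definition decomposable :: "nat list \<Rightarrow> bool" where
  "decomposable p \<longleftrightarrow>
     (\<exists>q r. is_perm q \<and> is_perm r \<and> q \<noteq> [] \<and> r \<noteq> [] \<and> p = perm_sum q r)"

definition indecomposable :: "nat list \<Rightarrow> bool" where
  "indecomposable p \<longleftrightarrow> is_perm p \<and> p \<noteq> [] \<and> \<not> decomposable p"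

definition inversions :: "nat list \<Rightarrow> (nat \<times> nat) set" where
  "inversions p = {(i, j). i < j \<and> j < length p \<and> p ! i > p ! j}"

definition contains :: "nat list \<Rightarrow> nat list \<Rightarrow> bool" where
  "contains p t \<longleftrightarrow>
     (\<exists>f :: nat \<Rightarrow> nat.
        strict_mono_on {..<length t} f \<and>
        (\<forall>a < length t. f a < length p) \<and>
        (\<forall>a < length t. \<forall>b < length t. p ! f a < p ! f b \<longleftrightarrow> t ! a < t ! b))"

definition avoids :: "nat list \<Rightarrow> nat list \<Rightarrow> bool" where
  "avoids p t \<longleftrightarrow> \<not> contains p t"

definition indec_avoiders :: "nat \<Rightarrow> nat list set \<Rightarrow> nat list set" where
  "indec_avoiders k T =
     {p. indecomposable p \<and> card (inversions p) = k \<and> (\<forall>t \<in> T. avoids p t)}"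

text \<open>The row at height \<open>i + 1\<close> of the polyomino \<open>(l, r)\<close> is the segment \<open>[l ! i, r ! i]\<close>.\<close>

definition parallelogram_polyomino :: "nat list \<times> nat list \<Rightarrow> bool" where
  "parallelogram_polyomino = (\<lambda>(l, r).
     length l = length r \<and> length l \<ge> 1 \<and>
     sorted l \<and> sorted r \<and> l ! 0 = 0 \<and>
     (\<forall>i < length l. l ! i < r ! i) \<and>
     (\<forall>i. Suc i < length l \<longrightarrow> l ! Suc i < r ! i))"

text \<open>Subtraction on \<open>nat\<close> does not truncate here, as \<open>l ! i < r ! i\<close> in a polyomino.\<close>

definition cells :: "nat list \<times> nat list \<Rightarrow> nat" where
  "cells = (\<lambda>(l, r). \<Sum>i < length l. r ! i - l ! i)"

definition polyominoes :: "nat \<Rightarrow> (nat list \<times> nat list) set" where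
  "polyominoes k = {P. parallelogram_polyomino P \<and> cells P = k}"

end

theory Submission imports Defs begin

text \<open>Let \<open>p\<close> be an indecomposable permutation avoiding 321 with at least two entries. Indecomposability
  puts every entry into some inversion, and a 321-free permutation has no entry with both a larger
  entry before it and a smaller one after it. So the entries split into \<^emph>\<open>upper\<close> ones, which are
  the first members of inversions, and \<^emph>\<open>lower\<close> ones, which are the second members; both kinds
  increase from left to right, and the upper entries are exactly the strict excedances.
  The lower entries that form an inversion with the \<open>i\<close>-th upper entry are consecutive among the lower
  ones, say those with index in \<open>{L\<^sub>i..<R\<^sub>i}\<close>: the first \<open>L\<^sub>i\<close> lower entries stand to the left of it, and
  the first \<open>R\<^sub>i\<close> lower entries have a smaller value. These intervals are the rows of a parallelogram
  polyomino, and its cells are the inversions of \<open>p\<close>; that consecutive rows overlap is exactly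
  indecomposability (\<open>poly_of_polyomino\<close>, \<open>cells_poly_of\<close>).

  With both indices counted from 0, the \<open>i\<close>-th upper entry stands at position \<open>i + L\<^sub>i\<close> and
  has value \<open>i + R\<^sub>i + 1\<close>. Hence the polyomino determines the excedances, and these determine \<open>p\<close>,
  because the other entries increase (\<open>poly_of_inj\<close>). Conversely, given a polyomino,
  the \<open>j\<close>-th lower entry must stand at position \<open>j\<close> plus the number of \<open>i\<close> with \<open>L\<^sub>i \<le> j\<close>, and have as
  value \<open>j + 1\<close> plus the number of \<open>i\<close> with \<open>R\<^sub>i \<le> j\<close>. That this is a permutation is the
  fact that such pairs of sequences are complementary (\<open>complementary_sequences\<close>). So \<open>poly_of\<close>
  is a bijection; the assumption \<open>k \<ge> 1\<close> excludes the permutation of length 1, which is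
  indecomposable without having an inversion.\<close>

section \<open>Excedances of indecomposable permutations avoiding 321\<close>

lemma perm_nth_range:
  assumes "is_perm p" "i < length p"
  shows "1 \<le> p ! i" "p ! i \<le> length p"
proof -
  have "p ! i \<in> {1..length p}"
    using assms nth_mem unfolding is_perm_def by blast
  then show "1 \<le> p ! i" "p ! i \<le> length p" by auto
qed

lemma perm_nth_eq_iff:
  assumes "is_perm p" "i < length p" "j < length p"
  shows "p ! i = p ! j \<longleftrightarrow> i = j"
  using assms nth_eq_iff_index_eq unfolding is_perm_def by blast

lemma perm_nth_ex:
  assumes "is_perm p" "1 \<le> v" "v \<le> length p"
  obtains i where "i < length p" "p ! i = v"
proof -
  have "v \<in> set p" using assms by (simp add: is_perm_def)
  then show thesis using that by (auto simp: in_set_conv_nth)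
qed

lemma card_positions_below:
  assumes "is_perm p" "1 \<le> v" "v \<le> Suc (length p)"
  shows "card {i. i < length p \<and> p ! i < v} = v - 1"
proof -
  have "bij_betw ((!) p) {i. i < length p \<and> p ! i < v} {1..<v}"
    unfolding bij_betw_def
  proof
    show "inj_on ((!) p) {i. i < length p \<and> p ! i < v}"
      using perm_nth_eq_iff[OF assms(1)] by (auto simp: inj_on_def)
    show "(!) p ` {i. i < length p \<and> p ! i < v} = {1..<v}"
    proof
      show "(!) p ` {i. i < length p \<and> p ! i < v} \<subseteq> {1..<v}"
        using perm_nth_range[OF assms(1)] by auto
      show "{1..<v} \<subseteq> (!) p ` {i. i < length p \<and> p ! i < v}"
      proof
        fix w assume w: "w \<in> {1..<v}"
        then obtain i where "i < length p" "p ! i = w"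
          using assms perm_nth_ex[OF assms(1), of w] by auto
        then show "w \<in> (!) p ` {i. i < length p \<and> p ! i < v}" using w by auto
      qed
    qed
  qed
  from bij_betw_same_card[OF this] show ?thesis by simp
qed

text \<open>Together with its converse below, this replaces decomposability by a condition on entries.\<close>

lemma decomposable_if_prefix:
  assumes p: "is_perm p" and m: "0 < m" "m < length p"
    and pre: "\<And>i. i < m \<Longrightarrow> p ! i \<le> m"
  shows "decomposable p"
proof -
  have d: "distinct p" and sp: "set p = {1..length p}" using p by (auto simp: is_perm_def)
  have "set (take m p) \<subseteq> {1..m}"
  proof
    fix x assume "x \<in> set (take m p)"
    then obtain i where "i < m" "x = p ! i" using m by (auto simp: in_set_conv_nth)
    then show "x \<in> {1..m}" using pre perm_nth_range[OF p, of i] m by auto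
  qed
  moreover have "card (set (take m p)) = m"
    using d m by (simp add: distinct_card)
  ultimately have st: "set (take m p) = {1..m}"
    by (simp add: card_subset_eq)
  have "set (take m p) \<union> set (drop m p) = set p"
    by (metis append_take_drop_id set_append)
  moreover have "set (take m p) \<inter> set (drop m p) = {}"
    using d by (metis append_take_drop_id distinct_append)
  ultimately have "set (drop m p) = set p - set (take m p)" by blast
  also have "\<dots> = {Suc m..length p}"
    unfolding st sp by (auto simp only: Diff_iff atLeastAtMost_iff Suc_le_eq not_le)
  finally have sd: "set (drop m p) = {Suc m..length p}" .
  define r where "r = map (\<lambda>x. x - m) (drop m p)"
  have "inj_on (\<lambda>x. x - m) (set (drop m p))"
    unfolding sd by (auto simp: inj_on_def)
  then have "distinct r" using d by (simp add: r_def distinct_map)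
  moreover have "set r = {1..length r}"
  proof -
    have "(\<lambda>x. x - m) ` {Suc m..length p} = {1..length p - m}"
    proof
      show "{1..length p - m} \<subseteq> (\<lambda>x. x - m) ` {Suc m..length p}"
      proof
        fix y assume "y \<in> {1..length p - m}"
        then have "y = (y + m) - m" "y + m \<in> {Suc m..length p}" by auto
        then show "y \<in> (\<lambda>x. x - m) ` {Suc m..length p}" by (rule image_eqI)
      qed
    qed auto
    then show ?thesis using sd by (simp add: r_def)
  qed
  ultimately have "is_perm r" by (simp add: is_perm_def)
  moreover have "is_perm (take m p)" using d st m by (simp add: is_perm_def)
  moreover have "p = perm_sum (take m p) r"
  proof -
    have "map (\<lambda>x. m + x) r = drop m p"
      unfolding r_def map_map by (rule map_idI) (use sd in auto)
    then show ?thesis using m by (simp add: perm_sum_def)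
  qed
  moreover have "take m p \<noteq> []" "r \<noteq> []" using m by (auto simp: r_def)
  ultimately show ?thesis unfolding decomposable_def by blast
qed

lemma decomposable_prefix:
  assumes "decomposable p"
  obtains m where "0 < m" "m < length p" "\<And>i. i < m \<Longrightarrow> p ! i \<le> m"
proof -
  obtain q r where q: "is_perm q" "q \<noteq> []" and r: "is_perm r" "r \<noteq> []" and p: "p = perm_sum q r"
    using assms by (auto simp: decomposable_def)
  show thesis
  proof
    show "0 < length q" using q by simp
    show "length q < length p" using r by (simp add: p perm_sum_def)
    show "p ! i \<le> length q" if "i < length q" for i
      using perm_nth_range[OF q(1) that] that by (simp add: p perm_sum_def nth_append)
  qed
qed

lemma avoids_321_iff:
  "avoids p [3, 2, 1] \<longleftrightarrow>
     (\<forall>h i j. h < i \<longrightarrow> i < j \<longrightarrow> j < length p \<longrightarrow> p ! h > p ! i \<longrightarrow> \<not> p ! i > p ! j)"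
    (is "_ \<longleftrightarrow> ?R")
proof
  assume av: "avoids p [3, 2, 1]"
  show ?R
  proof (intro allI impI notI)
    fix h i j assume *: "h < i" "i < j" "j < length p" "p ! h > p ! i" "p ! i > p ! j"
    define f where "f = (\<lambda>a::nat. if a = 0 then h else if a = 1 then i else j)"
    have "contains p [3, 2, 1]"
      unfolding contains_def
    proof (intro exI[of _ f] conjI)
      show "strict_mono_on {..<length [3, 2, 1::nat]} f"
        using * by (auto simp: strict_mono_on_def f_def)
      show "\<forall>a<length [3, 2, 1::nat]. f a < length p"
        using * by (auto simp: f_def)
      show "\<forall>a<length [3, 2, 1::nat]. \<forall>b<length [3, 2, 1::nat].
              p ! f a < p ! f b \<longleftrightarrow> [3, 2, 1::nat] ! a < [3, 2, 1] ! b"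
        using * by (auto simp: f_def less_Suc_eq numeral_3_eq_3)
    qed
    then show False using av by (simp add: avoids_def)
  qed
next
  assume R: ?R
  show "avoids p [3, 2, 1]"
    unfolding avoids_def
  proof
    assume "contains p [3, 2, 1]"
    then obtain f :: "nat \<Rightarrow> nat" where
      sm: "strict_mono_on {..<3} f" and ran: "\<forall>a<3. f a < length p"
      and iso: "\<forall>a<3. \<forall>b<3. p ! f a < p ! f b \<longleftrightarrow> [3, 2, 1::nat] ! a < [3, 2, 1] ! b"
      by (auto simp: contains_def numeral_3_eq_3)
    have "f 0 < f 1" "f 1 < f 2" using sm by (auto simp: strict_mono_on_def)
    moreover have "f 2 < length p" using ran by simp
    moreover have "p ! f 1 < p ! f 0" "p ! f 2 < p ! f 1"
      using iso by auto
    ultimately show False using R by blast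
  qed
qed

text \<open>A strict excedance: since positions count from 0 and values from 1, an entry at position \<open>i\<close> with
  value \<open>Suc i\<close> is a fixed point.\<close>

definition exc :: "nat list \<Rightarrow> nat \<Rightarrow> bool" where
  "exc p i \<longleftrightarrow> i < length p \<and> Suc i < p ! i"

text \<open>The positions of the excedances, in increasing order.\<close>

definition excs :: "nat list \<Rightarrow> nat list" where
  "excs p = filter (exc p) [0..<length p]"

text \<open>The polyomino of an indecomposable 321-avoider \<open>p\<close>, with one row for each excedance. The \<open>i\<close>-th excedance has the
  \<open>i\<close> earlier excedances both to its left and below it, and subtracting them leaves the numbers of
  non-excedances to its left and below it, which are the two ends of the row. The subtractions do
  not truncate, since the \<open>i\<close>-th excedance stands at position \<open>i\<close> or later and has value greater
  than \<open>Suc i\<close>.\<close>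

definition poly_of :: "nat list \<Rightarrow> nat list \<times> nat list" where
  "poly_of p =
     (map (\<lambda>i. excs p ! i - i) [0..<length (excs p)],
      map (\<lambda>i. p ! (excs p ! i) - Suc i) [0..<length (excs p)])"

lemma set_excs: "set (excs p) = {i. exc p i}"
  by (auto simp: excs_def exc_def)

lemma sorted_excs: "sorted_wrt (<) (excs p)"
  unfolding excs_def by (rule sorted_wrt_filter) (rule sorted_wrt_upt)

lemma strict_increasing_ge_index:
  fixes f :: "nat \<Rightarrow> nat"
  assumes "\<And>i. Suc i < n \<Longrightarrow> f i < f (Suc i)" "i < n"
  shows "i \<le> f i"
  using assms(2)
proof (induction i)
  case (Suc i)
  then show ?case using assms(1)[of i] by simp
qed simp

lemma excedance_later_smaller:
  assumes p: "is_perm p" and e: "exc p i"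
  obtains j where "i < j" "j < length p" "p ! j < p ! i"
proof (rule ccontr)
  assume no: "\<not> thesis"
  \<comment> \<open>All \<open>p ! i - 1 > i\<close> smaller values would stand at the \<open>i\<close> positions before \<open>i\<close>.\<close>
  have i: "i < length p" "Suc i < p ! i" using e by (auto simp: exc_def)
  have "{j. j < length p \<and> p ! j < p ! i} \<subseteq> {..<i}"
  proof
    fix j assume j: "j \<in> {j. j < length p \<and> p ! j < p ! i}"
    then have "\<not> i < j" "i \<noteq> j" using no that by auto
    then show "j \<in> {..<i}" by simp
  qed
  from card_mono[OF finite_lessThan this]
  have "card {j. j < length p \<and> p ! j < p ! i} \<le> i" by simp
  then show False
    using card_positions_below[OF p, of "p ! i"] perm_nth_range[OF p i(1)] i by simp
qed

text \<open>A non-excedance that exceeds everything before it is a fixed point with all smaller values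
  before it, and then \<open>p\<close> can be cut just after it or, if it is the last entry, just before it.\<close>

lemma nonexcedance_earlier_larger:
  assumes ind: "indecomposable p" and n: "length p \<noteq> 1" and i: "i < length p" "\<not> exc p i"
  obtains h where "h < i" "p ! i < p ! h"
proof (rule ccontr)
  assume no: "\<not> thesis"
  note found = that
  have p: "is_perm p" and nd: "\<not> decomposable p" using ind by (auto simp: indecomposable_def)
  have le: "p ! i \<le> Suc i" using i by (auto simp: exc_def)
  have less: "p ! h < p ! i" if h: "h < i" for h
  proof -
    have "p ! h \<noteq> p ! i" "\<not> p ! i < p ! h"
      using no found h perm_nth_eq_iff[OF p, of h i] i by auto
    then show ?thesis by simp
  qed
  have "{..<i} \<subseteq> {j. j < length p \<and> p ! j < p ! i}" using less i by auto
  then have "card {..<i} \<le> card {j. j < length p \<and> p ! j < p ! i}"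
    by (intro card_mono) auto
  then have eq: "p ! i = Suc i"
    using card_positions_below[OF p, of "p ! i"] perm_nth_range[OF p i(1)] le by simp
  show False
  proof (cases "Suc i < length p")
    case True
    have "decomposable p"
    proof (rule decomposable_if_prefix[OF p _ True])
      show "p ! h \<le> Suc i" if "h < Suc i" for h
        using less[of h] eq that by (cases "h = i") auto
    qed simp
    then show False using nd by simp
  next
    case False
    then have i': "0 < i" "i < length p" using i n by auto
    have "decomposable p"
    proof (rule decomposable_if_prefix[OF p i'])
      show "p ! h \<le> i" if "h < i" for h
        using less[OF that] eq by simp
    qed
    then show False using nd by simp
  qed
qed

text \<open>Length 1 is excluded because a single fixed point has no earlier larger entry.\<close>

locale indec_321_avoider =
  fixes p :: "nat list"
  assumes indec: "indecomposable p"
    and avoids_321: "avoids p [3, 2, 1]"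
    and length_neq_1: "length p \<noteq> 1"
begin

lemma perm: "is_perm p" and not_decomposable: "\<not> decomposable p" and nonempty: "p \<noteq> []"
  using indec by (auto simp: indecomposable_def)

lemma no_321: "\<lbrakk>h < i; i < j; j < length p; p ! i < p ! h; p ! j < p ! i\<rbrakk> \<Longrightarrow> False"
  using avoids_321 unfolding avoids_321_iff by blast

lemma inversion_fst_exc:
  assumes "i < j" "j < length p" "p ! j < p ! i"
  shows "exc p i"
proof (rule ccontr)
  assume "\<not> exc p i"
  moreover have "i < length p" using assms by simp
  ultimately obtain h where "h < i" "p ! i < p ! h"
    using nonexcedance_earlier_larger[OF indec length_neq_1] by blast
  then show False using no_321 assms by blast
qed

lemma inversion_snd_not_exc:
  assumes "i < j" "j < length p" "p ! j < p ! i"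
  shows "\<not> exc p j"
proof
  assume "exc p j"
  then obtain h where "j < h" "h < length p" "p ! h < p ! j"
    using excedance_later_smaller[OF perm] by blast
  then show False using no_321 assms by blast
qed

lemma exc_increasing:
  assumes "i < j" "exc p i" "exc p j"
  shows "p ! i < p ! j"
proof -
  have "i < length p" "j < length p" using assms by (auto simp: exc_def)
  then have "p ! i \<noteq> p ! j" "\<not> p ! j < p ! i"
    using assms inversion_snd_not_exc[of i j] perm_nth_eq_iff[OF perm, of i j] by auto
  then show ?thesis by simp
qed

lemma nonexc_increasing:
  assumes "i < j" "j < length p" "\<not> exc p i" "\<not> exc p j"
  shows "p ! i < p ! j"
proof -
  have "p ! i \<noteq> p ! j" "\<not> p ! j < p ! i"
    using assms inversion_fst_exc[of i j] perm_nth_eq_iff[OF perm, of i j] by auto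
  then show ?thesis by simp
qed

lemma exc_0: "exc p 0"
  using nonexcedance_earlier_larger[OF indec length_neq_1, of 0] nonempty by blast

lemma exc_nth_excs: "i < length (excs p) \<Longrightarrow> exc p (excs p ! i)"
  using nth_mem set_excs by blast

lemma excs_mono: "\<lbrakk>i < j; j < length (excs p)\<rbrakk> \<Longrightarrow> excs p ! i < excs p ! j"
  using sorted_excs sorted_wrt_nth_less by blast

lemma excs_values_mono:
  "\<lbrakk>i < j; j < length (excs p)\<rbrakk> \<Longrightarrow> p ! (excs p ! i) < p ! (excs p ! j)"
  using exc_increasing excs_mono exc_nth_excs by simp

lemma excs_ge: "i < length (excs p) \<Longrightarrow> i \<le> excs p ! i"
  using strict_increasing_ge_index[where f = "(!) (excs p)"] excs_mono by blast

lemma excs_nonempty: "0 < length (excs p)"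
  using exc_0 set_excs[of p] by (metis empty_iff length_greater_0_conv list.set(1) mem_Collect_eq)

lemma excs_hd: "excs p ! 0 = 0"
proof -
  have "0 \<in> set (excs p)" using exc_0 set_excs by blast
  then obtain i where "i < length (excs p)" "excs p ! i = 0" by (auto simp: in_set_conv_nth)
  then show ?thesis using excs_mono[of 0 i] by (cases "i = 0") auto
qed

text \<open>If this failed, the first \<open>p ! (excs p ! i)\<close> positions would contain at most the excedances up to
  the \<open>i\<close>-th, and so only values up to \<open>p ! (excs p ! i)\<close>.\<close>

lemma excs_overlap:
  assumes "Suc i < length (excs p)"
  shows "excs p ! Suc i < p ! (excs p ! i)"
proof (rule ccontr)
  let ?E = "excs p"
  let ?v = "p ! (?E ! i)"
  assume "\<not> ?E ! Suc i < ?v"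
  then have ge: "?v \<le> ?E ! Suc i" by simp
  have "exc p (?E ! i)" "exc p (?E ! Suc i)" using exc_nth_excs assms by auto
  then have v: "0 < ?v" "?v < length p" using ge by (auto simp: exc_def)
  have "decomposable p"
  proof (rule decomposable_if_prefix[OF perm v])
    fix h assume h: "h < ?v"
    show "p ! h \<le> ?v"
    proof (cases "exc p h")
      case True
      then obtain j where j: "j < length ?E" "?E ! j = h"
        using set_excs[of p] by (metis in_set_conv_nth mem_Collect_eq)
      have "j \<le> i"
      proof (rule ccontr)
        assume "\<not> j \<le> i"
        then have "?E ! Suc i \<le> ?E ! j"
          using excs_mono[of "Suc i" j] j by (cases "Suc i = j") auto
        then show False using j h ge by simp
      qed
      then show ?thesis using excs_values_mono[of j i] j assms by (cases "j = i") auto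
    next
      case False
      then show ?thesis using h v by (auto simp: exc_def)
    qed
  qed
  then show False using not_decomposable by simp
qed

text \<open>The length of \<open>p\<close> can be read off from its excedances.\<close>

lemma last_excs: "p ! (excs p ! (length (excs p) - 1)) = length p"
proof -
  obtain i where i: "i < length p" "p ! i = length p"
    using perm_nth_ex[OF perm, of "length p"] nonempty by (auto simp: Suc_le_eq)
  have "exc p i"
  proof (rule ccontr)
    assume "\<not> exc p i"
    then obtain h where "h < i" "p ! i < p ! h"
      using nonexcedance_earlier_larger[OF indec length_neq_1 i(1)] by blast
    then show False using perm_nth_range[OF perm, of h] i by simp
  qed
  then obtain j where j: "j < length (excs p)" "excs p ! j = i"
    using set_excs[of p] by (metis in_set_conv_nth mem_Collect_eq)
  have "j = length (excs p) - 1"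
  proof (rule ccontr)
    assume "j \<noteq> length (excs p) - 1"
    then have *: "j < length (excs p) - 1" "length (excs p) - 1 < length (excs p)" using j by auto
    have "excs p ! (length (excs p) - 1) < length p"
      using exc_nth_excs[OF *(2)] by (simp add: exc_def)
    then show False
      using excs_values_mono[OF *] perm_nth_range[OF perm, of "excs p ! (length (excs p) - 1)"] i j
      by simp
  qed
  then show ?thesis using i j by simp
qed

lemma poly_of_polyomino: "parallelogram_polyomino (poly_of p)"
proof -
  let ?E = "excs p"
  define a where "a = length ?E"
  have gap: "Suc (?E ! i) < p ! (?E ! i)" "i \<le> ?E ! i" if "i < a" for i
    using exc_nth_excs[of i] excs_ge[of i] that by (auto simp: exc_def a_def)
  have "sorted (map (\<lambda>i. ?E ! i - i) [0..<a])"
    unfolding sorted_iff_nth_Suc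
  proof (intro allI impI)
    fix i assume "Suc i < length (map (\<lambda>i. ?E ! i - i) [0..<a])"
    then have "Suc i < a" by simp
    then show "map (\<lambda>i. ?E ! i - i) [0..<a] ! i \<le> map (\<lambda>i. ?E ! i - i) [0..<a] ! Suc i"
      using excs_mono[of i "Suc i"] by (simp add: a_def)
  qed
  moreover have "sorted (map (\<lambda>i. p ! (?E ! i) - Suc i) [0..<a])"
    unfolding sorted_iff_nth_Suc
  proof (intro allI impI)
    fix i assume "Suc i < length (map (\<lambda>i. p ! (?E ! i) - Suc i) [0..<a])"
    then have "Suc i < a" by simp
    then show "map (\<lambda>i. p ! (?E ! i) - Suc i) [0..<a] ! i
        \<le> map (\<lambda>i. p ! (?E ! i) - Suc i) [0..<a] ! Suc i"
      using excs_values_mono[of i "Suc i"] by (simp add: a_def)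
  qed
  moreover have "?E ! i - i < p ! (?E ! i) - Suc i" if "i < a" for i
    using gap[OF that] by simp
  moreover have "?E ! Suc i - Suc i < p ! (?E ! i) - Suc i" if "Suc i < a" for i
    using excs_overlap[of i] gap(2)[OF that] that by (simp add: a_def)
  ultimately show ?thesis
    using excs_nonempty excs_hd by (auto simp: parallelogram_polyomino_def poly_of_def a_def Suc_le_eq)
qed

text \<open>All entries before an excedance \<open>i\<close> are smaller, so \<open>i\<close> of the \<open>p ! i - 1\<close> smaller entries precede it.\<close>

lemma card_inversions_at:
  assumes "exc p i"
  shows "card {j. i < j \<and> j < length p \<and> p ! j < p ! i} = p ! i - Suc i"
proof -
  have i: "i < length p" using assms by (simp add: exc_def)
  have earlier: "p ! h < p ! i" if "h < i" for h
  proof -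
    have "p ! h \<noteq> p ! i" "\<not> p ! i < p ! h"
      using inversion_snd_not_exc[of h i] assms i that perm_nth_eq_iff[OF perm, of h i] by auto
    then show ?thesis by simp
  qed
  have "{j. j < length p \<and> p ! j < p ! i}
      = {..<i} \<union> {j. i < j \<and> j < length p \<and> p ! j < p ! i}"
  proof (intro equalityI subsetI)
    fix j assume "j \<in> {j. j < length p \<and> p ! j < p ! i}"
    then show "j \<in> {..<i} \<union> {j. i < j \<and> j < length p \<and> p ! j < p ! i}"
      by (cases "j = i") auto
  qed (use i earlier in auto)
  then have "card {j. j < length p \<and> p ! j < p ! i}
      = i + card {j. i < j \<and> j < length p \<and> p ! j < p ! i}"
    using card_Un_disjoint[of "{..<i}" "{j. i < j \<and> j < length p \<and> p ! j < p ! i}"] by force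
  then show ?thesis
    using card_positions_below[OF perm, of "p ! i"] perm_nth_range[OF perm i] by simp
qed

lemma cells_poly_of: "cells (poly_of p) = card (inversions p)"
proof -
  let ?E = "excs p"
  have "inversions p = (SIGMA i:{i. exc p i}. {j. i < j \<and> j < length p \<and> p ! j < p ! i})"
    using inversion_fst_exc by (auto simp: inversions_def)
  moreover have fin: "finite {i. exc p i}" using set_excs by (metis List.finite_set)
  ultimately have "card (inversions p) = (\<Sum>i\<in>{i. exc p i}. p ! i - Suc i)"
    using card_inversions_at by simp
  also have "\<dots> = (\<Sum>i\<in>set ?E. p ! i - Suc i)" by (simp add: set_excs)
  also have "\<dots> = sum_list (map (\<lambda>i. p ! i - Suc i) ?E)"
    using sorted_excs[of p] by (simp add: sum_list_distinct_conv_sum_set strict_sorted_iff)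
  also have "\<dots> = (\<Sum>i<length ?E. p ! (?E ! i) - Suc (?E ! i))"
    by (simp add: sum_list_sum_nth atLeast0LessThan)
  also have "\<dots> = (\<Sum>i<length ?E. (p ! (?E ! i) - Suc i) - (?E ! i - i))"
    by (rule sum.cong) (use excs_ge in auto)
  also have "\<dots> = cells (poly_of p)" by (simp add: cells_def poly_of_def)
  finally show ?thesis by simp
qed

end

section \<open>A permutation is determined by its polyomino\<close>

lemma perm_eqI_increasing_off:
  assumes p: "is_perm p" and q: "is_perm q" and len: "length p = length q"
    and on: "\<And>i. \<lbrakk>i < length p; i \<in> X\<rbrakk> \<Longrightarrow> p ! i = q ! i"
    and incp: "\<And>i j. \<lbrakk>i < j; j < length p; i \<notin> X; j \<notin> X\<rbrakk> \<Longrightarrow> p ! i < p ! j"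
    and incq: "\<And>i j. \<lbrakk>i < j; j < length p; i \<notin> X; j \<notin> X\<rbrakk> \<Longrightarrow> q ! i < q ! j"
  shows "p = q"
proof (rule nth_equalityI[OF len])
  \<comment> \<open>At the first difference \<open>i\<close>, a smaller value \<open>r ! i\<close> would have to occur in \<open>s\<close> elsewhere: not before \<open>i\<close>
    and not in \<open>X\<close>, where \<open>s\<close> agrees with \<open>r\<close>, and not outside \<open>X\<close> after \<open>i\<close>, where \<open>s\<close> is larger.\<close>
  have no_less: "\<not> r ! i < s ! i"
    if r: "is_perm r" and s: "is_perm s" and l: "length r = length s" and i: "i < length r"
      and before: "\<And>j. j < i \<Longrightarrow> r ! j = s ! j"
      and on': "\<And>i. \<lbrakk>i < length r; i \<in> X\<rbrakk> \<Longrightarrow> r ! i = s ! i"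
      and incs: "\<And>i j. \<lbrakk>i < j; j < length s; i \<notin> X; j \<notin> X\<rbrakk> \<Longrightarrow> s ! i < s ! j"
    for r s i
  proof
    assume less: "r ! i < s ! i"
    obtain j where j: "j < length s" "s ! j = r ! i"
      using perm_nth_ex[OF s, of "r ! i"] perm_nth_range[OF r i] l by auto
    have "j \<noteq> i" using less j by auto
    have "i \<notin> X" using on'[OF i] less by auto
    have neq: "r ! j \<noteq> r ! i" using perm_nth_eq_iff[OF r, of j i] j l i \<open>j \<noteq> i\<close> by simp
    have "j \<notin> X" using on'[of j] j l neq by auto
    have "\<not> j < i" using before[of j] j neq by auto
    then have "i < j" using \<open>j \<noteq> i\<close> by simp
    then have "s ! i < s ! j"
      using incs j(1) \<open>i \<notin> X\<close> \<open>j \<notin> X\<close> by blast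
    then show False using less j by simp
  qed
  fix i assume "i < length p"
  then show "p ! i = q ! i"
  proof (induction i rule: less_induct)
    case (less i)
    then have before: "p ! j = q ! j" if "j < i" for j using that by simp
    have "\<not> p ! i < q ! i"
      by (rule no_less[OF p q len less.prems before on]) (use incq len in auto)
    moreover have "\<not> q ! i < p ! i"
      by (rule no_less[OF q p len[symmetric]]) (use before on incp len less.prems in auto)
    ultimately show ?case by simp
  qed
qed

lemma poly_of_inj:
  assumes "indec_321_avoider p" "indec_321_avoider q" and eq: "poly_of p = poly_of q"
  shows "p = q"
proof -
  interpret p: indec_321_avoider p by fact
  interpret q: indec_321_avoider q by fact
  have la: "length (excs p) = length (excs q)"
    using arg_cong[OF eq, of "length \<circ> fst"] by (simp add: poly_of_def)
  have pos: "excs p ! i = excs q ! i" if "i < length (excs p)" for i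
  proof -
    have "fst (poly_of p) ! i = fst (poly_of q) ! i" using eq by simp
    then have "excs p ! i - i = excs q ! i - i" using that la by (simp add: poly_of_def)
    then show ?thesis using p.excs_ge[of i] q.excs_ge[of i] that la by simp
  qed
  then have E: "excs p = excs q" using la by (rule nth_equalityI[rotated])
  have val: "p ! (excs p ! i) = q ! (excs p ! i)" if "i < length (excs p)" for i
  proof -
    have "snd (poly_of p) ! i = snd (poly_of q) ! i" using eq by simp
    then have "p ! (excs p ! i) - Suc i = q ! (excs p ! i) - Suc i"
      using that E by (simp add: poly_of_def)
    moreover have "Suc i < p ! (excs p ! i)"
      using p.exc_nth_excs[OF that] p.excs_ge[OF that] by (simp add: exc_def)
    moreover have "Suc i < q ! (excs q ! i)"
      using q.exc_nth_excs[of i] q.excs_ge[of i] that E by (simp add: exc_def)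
    ultimately show ?thesis using E by simp
  qed
  have len: "length p = length q"
    using p.last_excs q.last_excs val[of "length (excs p) - 1"] p.excs_nonempty E by simp
  have X: "exc p i \<longleftrightarrow> exc q i" for i
    using E set_excs[of p] set_excs[of q] by auto
  show ?thesis
  proof (rule perm_eqI_increasing_off[where X = "{i. exc p i}"])
    show "p ! i = q ! i" if "i \<in> {i. exc p i}" for i
      using that val set_excs[of p] by (metis in_set_conv_nth)
    show "p ! i < p ! j" if "i < j" "j < length p" "i \<notin> {i. exc p i}" "j \<notin> {i. exc p i}" for i j
      using p.nonexc_increasing that by simp
    show "q ! i < q ! j" if "i < j" "j < length p" "i \<notin> {i. exc p i}" "j \<notin> {i. exc p i}" for i j
      using q.nonexc_increasing that X len by simp
  qed (rule p.perm q.perm len)+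
qed

section \<open>Complementary sequences\<close>

text \<open>For a weakly increasing \<open>f\<close> on \<open>{..<a}\<close>, the increasing enumeration of the numbers that are not of
  the form \<open>i + f i\<close> with \<open>i < a\<close>: exactly the \<open>i + f i\<close> with \<open>f i \<le> j\<close> lie below the \<open>j\<close>-th such number.\<close>

definition compl_seq :: "nat \<Rightarrow> (nat \<Rightarrow> nat) \<Rightarrow> nat \<Rightarrow> nat" where
  "compl_seq a f j = j + card {i. i < a \<and> f i \<le> j}"

lemma compl_seq_strict_mono: "j < j' \<Longrightarrow> compl_seq a f j < compl_seq a f j'"
proof -
  assume j: "j < j'"
  then have "card {i. i < a \<and> f i \<le> j} \<le> card {i. i < a \<and> f i \<le> j'}"
    by (intro card_mono) auto
  then show ?thesis using j by (simp add: compl_seq_def)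
qed

lemma compl_seq_antimono:
  assumes "\<And>i. i < a \<Longrightarrow> f i \<le> g i"
  shows "compl_seq a g j \<le> compl_seq a f j"
proof -
  have "{i. i < a \<and> g i \<le> j} \<subseteq> {i. i < a \<and> f i \<le> j}"
    using assms order_trans by blast
  then have "card {i. i < a \<and> g i \<le> j} \<le> card {i. i < a \<and> f i \<le> j}"
    by (intro card_mono) auto
  then show ?thesis by (simp add: compl_seq_def)
qed

lemma seq_less_compl_seq:
  assumes mono: "mono_on {..<a} f" and i: "i < a" "f i \<le> j"
  shows "i + f i < compl_seq a f j"
proof -
  have "{..i} \<subseteq> {i. i < a \<and> f i \<le> j}"
  proof
    fix h assume "h \<in> {..i}"
    then show "h \<in> {i. i < a \<and> f i \<le> j}" using mono_onD[OF mono, of h i] i by simp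
  qed
  then have "card {..i} \<le> card {i. i < a \<and> f i \<le> j}" by (intro card_mono) auto
  then show ?thesis using i by (simp add: compl_seq_def)
qed

lemma compl_seq_less_seq:
  assumes mono: "mono_on {..<a} f" and i: "i < a" "j < f i"
  shows "compl_seq a f j < i + f i"
proof -
  have "{i. i < a \<and> f i \<le> j} \<subseteq> {..<i}"
  proof
    fix h assume "h \<in> {i. i < a \<and> f i \<le> j}"
    then show "h \<in> {..<i}" using mono_onD[OF mono, of i h] i by (cases "i \<le> h") auto
  qed
  then have "card {i. i < a \<and> f i \<le> j} \<le> card {..<i}" by (intro card_mono) auto
  then show ?thesis using i by (simp add: compl_seq_def)
qed

lemma complementary_sequences:
  assumes mono: "mono_on {..<a} f" and le: "\<forall>i<a. f i \<le> b"
  shows "inj_on (\<lambda>i. i + f i) {..<a}" "inj_on (compl_seq a f) {..<b}"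
    and "(\<lambda>i. i + f i) ` {..<a} \<inter> compl_seq a f ` {..<b} = {}"
    and "(\<lambda>i. i + f i) ` {..<a} \<union> compl_seq a f ` {..<b} = {..<a + b}"
proof -
  let ?u = "\<lambda>i. i + f i" and ?g = "compl_seq a f"
  show iu: "inj_on ?u {..<a}"
  proof (rule linorder_inj_onI')
    fix i j assume "i \<in> {..<a}" "j \<in> {..<a}" "i < j"
    then show "i + f i \<noteq> j + f j" using mono_onD[OF mono, of i j] by simp
  qed
  show ig: "inj_on ?g {..<b}"
    by (rule linorder_inj_onI') (use compl_seq_strict_mono less_imp_neq in blast)
  show dis: "?u ` {..<a} \<inter> ?g ` {..<b} = {}"
  proof -
    have "i + f i \<noteq> ?g j" if "i < a" for i j :: nat
    proof (cases "f i \<le> j")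
      case True
      then show ?thesis using seq_less_compl_seq[OF mono that] by force
    next
      case False
      then show ?thesis using compl_seq_less_seq[OF mono that, of j] by force
    qed
    then show ?thesis by auto
  qed
  have "?g j < a + b" if "j < b" for j
  proof -
    have "card {i. i < a \<and> f i \<le> j} \<le> card {..<a}" by (intro card_mono) auto
    then show ?thesis using that by (simp add: compl_seq_def)
  qed
  moreover have "i + f i < a + b" if "i < a" for i using le that by (simp add: add_less_le_mono)
  ultimately have sub: "?u ` {..<a} \<union> ?g ` {..<b} \<subseteq> {..<a + b}" by auto
  have "card (?u ` {..<a} \<union> ?g ` {..<b}) = a + b"
    using iu ig dis by (simp add: card_Un_disjoint card_image)
  then show "?u ` {..<a} \<union> ?g ` {..<b} = {..<a + b}"
    using sub by (simp add: card_subset_eq)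
qed

section \<open>Every polyomino comes from a permutation\<close>

locale polyomino =
  fixes l r :: "nat list"
  assumes polyomino: "parallelogram_polyomino (l, r)"
begin

text \<open>The number of rows and the width of the polyomino, which are the numbers of upper and of lower
  entries of the permutation to be built.\<close>

definition a :: nat where "a = length l"
definition b :: nat where "b = r ! (a - 1)"

lemma length_l [simp]: "length l = a" and length_r [simp]: "length r = a" and a_pos: "0 < a"
  and l_0: "l ! 0 = 0"
  and row_nonempty: "i < a \<Longrightarrow> l ! i < r ! i"
  and rows_overlap: "Suc i < a \<Longrightarrow> l ! Suc i < r ! i"
  using polyomino by (auto simp: parallelogram_polyomino_def a_def Suc_le_eq)

lemma l_mono: "\<lbrakk>i \<le> i'; i' < a\<rbrakk> \<Longrightarrow> l ! i \<le> l ! i'"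
  and r_mono: "\<lbrakk>i \<le> i'; i' < a\<rbrakk> \<Longrightarrow> r ! i \<le> r ! i'"
proof -
  have "sorted l" "sorted r" using polyomino by (auto simp: parallelogram_polyomino_def)
  then show "\<lbrakk>i \<le> i'; i' < a\<rbrakk> \<Longrightarrow> l ! i \<le> l ! i'" "\<lbrakk>i \<le> i'; i' < a\<rbrakk> \<Longrightarrow> r ! i \<le> r ! i'"
    by (simp_all add: sorted_nth_mono)
qed

lemma r_le: "i < a \<Longrightarrow> r ! i \<le> b"
  unfolding b_def by (rule r_mono) auto

lemma l_le: "i < a \<Longrightarrow> l ! i \<le> b"
  using row_nonempty[of i] r_le[of i] by simp

text \<open>The position of the \<open>j\<close>-th lower entry, and its value diminished by 1.\<close>

abbreviation pos :: "nat \<Rightarrow> nat" where "pos \<equiv> compl_seq a ((!) l)"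
abbreviation val :: "nat \<Rightarrow> nat" where "val \<equiv> compl_seq a ((!) r)"

lemma mono_on_l: "mono_on {..<a} ((!) l)" and mono_on_r: "mono_on {..<a} ((!) r)"
  using l_mono r_mono by (auto intro!: mono_onI)

lemma l_bounded: "\<forall>i<a. l ! i \<le> b" and r_bounded: "\<forall>i<a. r ! i \<le> b"
  using l_le r_le by auto

lemmas positions = complementary_sequences[OF mono_on_l l_bounded]
lemmas vals = complementary_sequences[OF mono_on_r r_bounded]

text \<open>The permutation whose \<open>i\<close>-th upper entry has position \<open>i + l ! i\<close> and value \<open>Suc (i + r ! i)\<close>,
  and whose \<open>j\<close>-th lower entry has position \<open>pos j\<close> and value \<open>Suc (val j)\<close>.\<close>

definition perm_of :: "nat list" where
  "perm_of = map (\<lambda>x. Suc (if x \<in> (\<lambda>i. i + l ! i) ` {..<a}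
       then (\<lambda>i. i + r ! i) (the_inv_into {..<a} (\<lambda>i. i + l ! i) x)
       else val (the_inv_into {..<b} pos x))) [0..<a + b]"

lemma length_perm_of [simp]: "length perm_of = a + b"
  by (simp add: perm_of_def)

lemma upper_pos_less: "i < a \<Longrightarrow> i + l ! i < a + b"
  using l_le[of i] by simp

lemma lower_pos_less: "j < b \<Longrightarrow> pos j < a + b"
  using positions(4) by blast

lemma perm_of_upper: "i < a \<Longrightarrow> perm_of ! (i + l ! i) = Suc (i + r ! i)"
  using upper_pos_less[of i] the_inv_into_f_f[OF positions(1), of i] by (simp add: perm_of_def)

lemma perm_of_lower: "j < b \<Longrightarrow> perm_of ! pos j = Suc (val j)"
  using lower_pos_less[of j] the_inv_into_f_f[OF positions(2), of j] positions(3)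
  by (auto simp: perm_of_def)

lemma position_cases:
  assumes "x < a + b"
  obtains (upper) i where "i < a" "x = i + l ! i" | (lower) j where "j < b" "x = pos j"
  using assms positions(4) by blast

lemma is_perm_perm_of: "is_perm perm_of"
proof -
  have "set perm_of = (!) perm_of ` {..<a + b}"
    by (auto simp: set_conv_nth)
  also have "\<dots> = (!) perm_of ` (\<lambda>i. i + l ! i) ` {..<a} \<union> (!) perm_of ` pos ` {..<b}"
    unfolding positions(4)[symmetric] by (rule image_Un)
  also have "(!) perm_of ` (\<lambda>i. i + l ! i) ` {..<a} = Suc ` (\<lambda>i. i + r ! i) ` {..<a}"
    unfolding image_image by (rule image_cong) (auto simp: perm_of_upper)
  also have "(!) perm_of ` pos ` {..<b} = Suc ` val ` {..<b}"
    unfolding image_image by (rule image_cong) (auto simp: perm_of_lower)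
  also have "Suc ` (\<lambda>i. i + r ! i) ` {..<a} \<union> Suc ` val ` {..<b} = Suc ` {..<a + b}"
    by (simp only: vals(4)[symmetric] image_Un)
  also have "\<dots> = {1..a + b}"
    by (simp add: image_Suc_lessThan)
  finally have "set perm_of = {1..length perm_of}" by simp
  then show ?thesis by (simp add: is_perm_def card_distinct)
qed

lemma exc_upper: "i < a \<Longrightarrow> exc perm_of (i + l ! i)"
  using upper_pos_less[of i] row_nonempty[of i] by (simp add: exc_def perm_of_upper)

lemma not_exc_lower: "j < b \<Longrightarrow> \<not> exc perm_of (pos j)"
  using compl_seq_antimono[of a "(!) l" "(!) r" j] row_nonempty
  by (simp add: exc_def perm_of_lower less_imp_le not_less)

lemma pos_less_iff: "pos j < pos j' \<longleftrightarrow> j < j'"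
  using compl_seq_strict_mono by (metis linorder_neqE_nat less_asym less_irrefl)

lemma upper_pos_less_iff: "\<lbrakk>i < a; i' < a\<rbrakk> \<Longrightarrow> i + l ! i < i' + l ! i' \<longleftrightarrow> i < i'"
  using l_mono[of i i'] l_mono[of i' i] by (cases "i < i'") auto

lemma avoids_perm_of: "avoids perm_of [3, 2, 1]"
proof -
  have up: "perm_of ! x < perm_of ! y" if xy: "x < y" "exc perm_of x" "exc perm_of y" for x y
  proof -
    have "x < a + b" "y < a + b" using xy by (auto simp: exc_def)
    then obtain i i' where "i < a" "x = i + l ! i" "i' < a" "y = i' + l ! i'"
      using position_cases not_exc_lower xy by metis
    then show ?thesis
      using xy upper_pos_less_iff[of i i'] r_mono[of i i'] by (simp add: perm_of_upper)
  qed
  have low: "perm_of ! x < perm_of ! y"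
    if xy: "x < y" "y < a + b" "\<not> exc perm_of x" "\<not> exc perm_of y" for x y
  proof -
    have "x < a + b" using xy by simp
    then obtain j j' where "j < b" "x = pos j" "j' < b" "y = pos j'"
      using position_cases exc_upper xy by metis
    then show ?thesis
      using xy pos_less_iff compl_seq_strict_mono by (simp add: perm_of_lower)
  qed
  show ?thesis
    unfolding avoids_321_iff
  proof (intro allI impI notI)
    fix h i j
    assume *: "h < i" "i < j" "j < length perm_of"
      "perm_of ! i < perm_of ! h" "perm_of ! j < perm_of ! i"
    \<comment> \<open>Two of the three positions are both excedances or both not.\<close>
    have "h < j" "i < a + b" "j < a + b" "perm_of ! j < perm_of ! h" using * by auto
    then show False using * up[of h i] up[of i j] up[of h j] low[of h i] low[of i j] low[of h j]
      by (meson less_asym)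
  qed
qed

lemma indecomposable_perm_of: "indecomposable perm_of"
proof -
  have "\<not> decomposable perm_of"
  proof
    assume "decomposable perm_of"
    then obtain m where m: "0 < m" "m < a + b" and pre: "\<And>x. x < m \<Longrightarrow> perm_of ! x \<le> m"
      using decomposable_prefix by (metis length_perm_of)
    \<comment> \<open>By the overlap of consecutive rows, the first \<open>m\<close> positions contain with each upper entry also the
      next one, and so in the end the largest value.\<close>
    have "i + l ! i < m" if "i < a" for i
      using that
    proof (induction i)
      case 0
      then show ?case using m l_0 by simp
    next
      case (Suc i)
      then have "Suc (i + r ! i) \<le> m" using pre[of "i + l ! i"] perm_of_upper[of i] by simp
      then show ?case using rows_overlap[OF Suc.prems] by simp
    qed
    from pre[OF this[of "a - 1"]] have "Suc (a - 1 + b) \<le> m"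
      using a_pos perm_of_upper[of "a - 1"] by (simp add: b_def)
    then show False using m by simp
  qed
  then show ?thesis
    using is_perm_perm_of a_pos by (auto simp: indecomposable_def simp flip: length_greater_0_conv)
qed

lemma b_pos: "0 < b"
  using row_nonempty[of "a - 1"] a_pos by (simp add: b_def)

lemma indec_321_avoider_perm_of: "indec_321_avoider perm_of"
proof
  show "length perm_of \<noteq> 1" using a_pos b_pos by simp
qed (rule indecomposable_perm_of avoids_perm_of)+

lemma excs_perm_of: "excs perm_of = map (\<lambda>i. i + l ! i) [0..<a]"
proof (rule strict_sorted_equal)
  show "sorted_wrt (<) (excs perm_of)" by (rule sorted_excs)
  show "sorted_wrt (<) (map (\<lambda>i. i + l ! i) [0..<a])"
    by (auto simp: sorted_wrt_iff_nth_less upper_pos_less_iff)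
  show "set (excs perm_of) = set (map (\<lambda>i. i + l ! i) [0..<a])"
  proof -
    have "exc perm_of x \<longleftrightarrow> x \<in> (\<lambda>i. i + l ! i) ` {..<a}" for x
    proof
      assume x: "exc perm_of x"
      then have "x < a + b" by (simp add: exc_def)
      then show "x \<in> (\<lambda>i. i + l ! i) ` {..<a}"
        by (cases rule: position_cases) (use x not_exc_lower in auto)
    qed (use exc_upper in auto)
    then show ?thesis by (auto simp: set_excs)
  qed
qed

lemma poly_of_perm_of: "poly_of perm_of = (l, r)"
proof -
  have "map (\<lambda>i. i + l ! i - i) [0..<a] = l"
    by (rule nth_equalityI) auto
  moreover have "map (\<lambda>i. perm_of ! (i + l ! i) - Suc i) [0..<a] = r"
    by (rule nth_equalityI) (auto simp: perm_of_upper)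
  moreover have "poly_of perm_of =
      (map (\<lambda>i. i + l ! i - i) [0..<a], map (\<lambda>i. perm_of ! (i + l ! i) - Suc i) [0..<a])"
    by (simp add: poly_of_def excs_perm_of)
  ultimately show ?thesis by simp
qed

text \<open>Since consecutive rows overlap, each of the first \<open>r ! i\<close> columns meets one of the rows up to the \<open>i\<close>-th.\<close>

lemma r_le_cells: "i < a \<Longrightarrow> r ! i \<le> (\<Sum>h\<le>i. r ! h - l ! h)"
proof (induction i)
  case 0
  then show ?case by (simp add: l_0)
next
  case (Suc i)
  then show ?case using rows_overlap[OF Suc.prems] row_nonempty[OF Suc.prems] by simp
qed

lemma bounded_by_cells:
  shows "a \<le> cells (l, r)" and "set l \<subseteq> {..cells (l, r)}" and "set r \<subseteq> {..cells (l, r)}"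
proof -
  have "(\<Sum>i<a. 1) \<le> (\<Sum>i<a. r ! i - l ! i)"
    by (rule sum_mono) (use row_nonempty in \<open>auto simp: Suc_le_eq\<close>)
  then show "a \<le> cells (l, r)" by (simp add: cells_def)
  have r: "r ! i \<le> cells (l, r)" if "i < a" for i
  proof -
    have "(\<Sum>h\<le>i. r ! h - l ! h) \<le> (\<Sum>h<a. r ! h - l ! h)"
      using that by (intro sum_mono2) auto
    then show ?thesis using r_le_cells[OF that] by (simp add: cells_def)
  qed
  then show "set r \<subseteq> {..cells (l, r)}" by (auto simp: in_set_conv_nth)
  show "set l \<subseteq> {..cells (l, r)}"
    using r row_nonempty by (fastforce simp: in_set_conv_nth)
qed

end

section \<open>The bijection\<close>

lemma finite_polyominoes: "finite (polyominoes k)"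
proof (rule finite_subset)
  let ?B = "{xs. set xs \<subseteq> {..k} \<and> length xs \<le> k}"
  show "polyominoes k \<subseteq> ?B \<times> ?B"
  proof (rule subrelI)
    fix l r assume "(l, r) \<in> polyominoes k"
    then have "polyomino l r" and k: "cells (l, r) = k"
      by (auto simp: polyominoes_def polyomino_def)
    then interpret polyomino l r by simp
    show "(l, r) \<in> ?B \<times> ?B" using bounded_by_cells k by simp
  qed
  show "finite (?B \<times> ?B)" by (intro finite_cartesian_product finite_lists_length_le) auto
qed

lemma bij_betw_poly_of:
  assumes "k \<ge> 1"
  shows "bij_betw poly_of (indec_avoiders k {[3, 2, 1]}) (polyominoes k)"
proof -
  have A: "indec_321_avoider p" if "p \<in> indec_avoiders k {[3, 2, 1]}" for p
  proof
    show "indecomposable p" "avoids p [3, 2, 1]" using that by (auto simp: indec_avoiders_def)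
    show "length p \<noteq> 1"
    proof
      assume "length p = 1"
      then have "inversions p = {}" by (auto simp: inversions_def)
      then show False using that assms by (simp add: indec_avoiders_def)
    qed
  qed
  show ?thesis
    unfolding bij_betw_def
  proof
    show "inj_on poly_of (indec_avoiders k {[3, 2, 1]})"
      using A poly_of_inj by (auto intro: inj_onI)
    show "poly_of ` indec_avoiders k {[3, 2, 1]} = polyominoes k"
    proof
      show "poly_of ` indec_avoiders k {[3, 2, 1]} \<subseteq> polyominoes k"
        using A indec_321_avoider.poly_of_polyomino indec_321_avoider.cells_poly_of
        by (fastforce simp: polyominoes_def indec_avoiders_def)
      show "polyominoes k \<subseteq> poly_of ` indec_avoiders k {[3, 2, 1]}"
      proof clarify
        fix l r assume "(l, r) \<in> polyominoes k"
        then have "polyomino l r" and k: "cells (l, r) = k"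
          by (auto simp: polyominoes_def polyomino_def)
        then interpret polyomino l r by simp
        have "card (inversions perm_of) = k"
          using indec_321_avoider.cells_poly_of[OF indec_321_avoider_perm_of] poly_of_perm_of k
          by simp
        then have "perm_of \<in> indec_avoiders k {[3, 2, 1]}"
          using indecomposable_perm_of avoids_perm_of by (simp add: indec_avoiders_def)
        then show "(l, r) \<in> poly_of ` indec_avoiders k {[3, 2, 1]}"
          using poly_of_perm_of by (metis image_eqI)
      qed
    qed
  qed
qed

theorem theorem5:
  fixes k :: nat
  assumes "k \<ge> 1"
  shows "finite (indec_avoiders k {[3, 2, 1]}) \<and> finite (polyominoes k) \<and>
         card (indec_avoiders k {[3, 2, 1]}) = card (polyominoes k)"
  using bij_betw_poly_of[OF assms] finite_polyominoes bij_betw_finite bij_betw_same_card by blast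

end
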